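(* Let $(G_1, G_2) \sim \mathbb{G}(n,1/2)^{\otimes 2}$, let $\mathcal{A} \in \mathsf{ONLINE}(n)$, and fix any $\varepsilon > 0$. For all $\omega \in \Omega$ and all sufficiently large $n$, we have that \[ \Pr\left(|\mathcal{A}(G_1, G_2, \omega)| \geq (2 + \varepsilon)\log_2 n \right) \leq n^{-\Omega(\log n)}. \]
   Context: $\mathbb{G}(n,1/2)^{\otimes 2}$ denotes two independent Erdős–Rényi random graphs on vertex set $[n]$ with edge probability $1/2$. The class $\mathsf{ONLINE}(n)$ consists of algorithms $\mathcal{A}$ taking as input two graphs $G_1,G_2$ on vertex set $[n]$ and a random string $\omega\in\Omega$. $\mathcal{A}$ proceeds in rounds $t=1,\dots,n$, and at the end of round $t$ maintains sets $P_1^{(t)},P_2^{(t)}\subseteq[n]$ of inspected vertices and sets $S_j^{(t)}\subseteq P_j^{(t)}$ with $G_1[S_1^{(t)}]\cong G_2[S_2^{(t)}]$; initially all four sets are empty. In round $t$: (1) based on $\omega$ and all information revealed through round $t-1$ (namely $P_j^{(t-1)}$, $G_j[P_j^{(t-1)}]$, $S_j^{(t-1)}$ for $j=1,2$), for $j\in\{1,2\}$ it selects $v_j^{(t)}\in[n]\setminus P_j^{(t-1)}$, sets $P_j^{(t)}=P_j^{(t-1)}\cup\{v_j^{(t)}\}$, and the edge statuses in $G_j$ of all not-yet-seen pairs inside $P_j^{(t)}$ are revealed; (2) based on $\omega$ and all information revealed so far, it either sets $(S_1^{(t)},S_2^{(t)})=(S_1^{(t-1)},S_2^{(t-1)})$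 or $(S_1^{(t-1)}\cup\{v_1\},S_2^{(t-1)}\cup\{v_2\})$ for some $v_j\in P_j^{(t)}$ with $v_1=v_1^{(t)}$ or $v_2=v_2^{(t)}$ (or both), maintaining $G_1[S_1^{(t)}]\cong G_2[S_2^{(t)}]$. The output is $\mathcal{A}(G_1,G_2,\omega)=(G_1[S_1^{(n)}],G_2[S_2^{(n)}])$, with size $|\mathcal{A}(G_1,G_2,\omega)|:=|S_1^{(n)}|=|S_2^{(n)}|$. The probability is over $(G_1,G_2)$ with $\omega$ fixed. *)

theory Defs
  imports "HOL-Probability.Probability"
begin

text \<open>A simple graph is a pair of a vertex set and a set of edges, each edge a two-element vertex set.\<close>

type_synonym graph = "nat set \<times> nat set set"

definition verts :: "graph \<Rightarrow> nat set" where
  "verts G = fst G"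

definition edges :: "graph \<Rightarrow> nat set set" where
  "edges G = snd G"

definition vertex_pairs :: "nat \<Rightarrow> nat set set" where
  "vertex_pairs n = {e. e \<subseteq> {1..n} \<and> card e = 2}"

definition graphs_on :: "nat \<Rightarrow> graph set" where
  "graphs_on n = {G. verts G = {1..n} \<and> edges G \<subseteq> vertex_pairs n}"

text \<open>Only used for \<open>S \<subseteq> verts G\<close>.\<close>

definition induced :: "graph \<Rightarrow> nat set \<Rightarrow> graph" where
  "induced G S = (S, {e \<in> edges G. e \<subseteq> S})"

definition graph_iso :: "graph \<Rightarrow> graph \<Rightarrow> bool" where
  "graph_iso G H \<longleftrightarrow>
     (\<exists>f. bij_betw f (verts G) (verts H) \<and>
          (\<forall>u\<in>verts G. \<forall>v\<in>verts G. {u, v} \<in> edges G \<longleftrightarrow> {f u, f v} \<in> edges H))"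

definition erdos_renyi :: "nat \<Rightarrow> real \<Rightarrow> graph pmf" where
  "erdos_renyi n p =
     map_pmf (\<lambda>b. ({1..n}, {e \<in> vertex_pairs n. b e}))
       (Pi_pmf (vertex_pairs n) False (\<lambda>_. bernoulli_pmf p))"

text \<open>
  The information available to an online algorithm: the revealed graphs \<open>G\<^sub>j[P\<^sub>j]\<close>, whose vertex sets
  are the inspected sets \<open>P\<^sub>j\<close>, together with \<open>S\<^sub>j\<close>. The round number and, for a fixed algorithm and
  random string, the whole history can be recomputed from this, so it is not passed separately.
\<close>

type_synonym view = "(graph \<times> nat set) \<times> (graph \<times> nat set)"

text \<open>
  \<open>select\<close> returns the pair of vertices inspected next. \<open>augment\<close> is given the view after their
  revelation (still with the old sets \<open>S\<^sub>j\<close>) and the pair itself; it returns \<open>None\<close> to keep the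
  sets \<open>S\<^sub>j\<close>, or \<open>Some\<close> of the pair of vertices to be added to them.
\<close>

record 'w online_alg =
  select :: "'w \<Rightarrow> view \<Rightarrow> nat \<times> nat"
  augment :: "'w \<Rightarrow> view \<Rightarrow> nat \<times> nat \<Rightarrow> (nat \<times> nat) option"

record state =
  P1 :: "nat set"
  P2 :: "nat set"
  S1 :: "nat set"
  S2 :: "nat set"

definition view_of :: "graph \<Rightarrow> graph \<Rightarrow> state \<Rightarrow> view" where
  "view_of G1 G2 s = ((induced G1 (P1 s), S1 s), (induced G2 (P2 s), S2 s))"

definition chosen :: "'w online_alg \<Rightarrow> 'w \<Rightarrow> graph \<Rightarrow> graph \<Rightarrow> state \<Rightarrow> nat \<times> nat" where
  "chosen A \<omega> G1 G2 s = select A \<omega> (view_of G1 G2 s)"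

definition inspect :: "'w online_alg \<Rightarrow> 'w \<Rightarrow> graph \<Rightarrow> graph \<Rightarrow> state \<Rightarrow> state" where
  "inspect A \<omega> G1 G2 s =
     s\<lparr>P1 := P1 s \<union> {fst (chosen A \<omega> G1 G2 s)}, P2 := P2 s \<union> {snd (chosen A \<omega> G1 G2 s)}\<rparr>"

definition decision ::
    "'w online_alg \<Rightarrow> 'w \<Rightarrow> graph \<Rightarrow> graph \<Rightarrow> state \<Rightarrow> (nat \<times> nat) option" where
  "decision A \<omega> G1 G2 s =
     augment A \<omega> (view_of G1 G2 (inspect A \<omega> G1 G2 s)) (chosen A \<omega> G1 G2 s)"

definition play_round :: "'w online_alg \<Rightarrow> 'w \<Rightarrow> graph \<Rightarrow> graph \<Rightarrow> state \<Rightarrow> state" where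
  "play_round A \<omega> G1 G2 s =
     (let s' = inspect A \<omega> G1 G2 s in
      case decision A \<omega> G1 G2 s of
        None \<Rightarrow> s'
      | Some (v1, v2) \<Rightarrow> s'\<lparr>S1 := S1 s \<union> {v1}, S2 := S2 s \<union> {v2}\<rparr>)"

text \<open>The state at the end of round \<open>t\<close>.\<close>

primrec run :: "'w online_alg \<Rightarrow> 'w \<Rightarrow> graph \<Rightarrow> graph \<Rightarrow> nat \<Rightarrow> state" where
  "run A \<omega> G1 G2 0 = \<lparr>P1 = {}, P2 = {}, S1 = {}, S2 = {}\<rparr>"
| "run A \<omega> G1 G2 (Suc t) = play_round A \<omega> G1 G2 (run A \<omega> G1 G2 t)"

definition legal_round :: "nat \<Rightarrow> 'w online_alg \<Rightarrow> 'w \<Rightarrow> graph \<Rightarrow> graph \<Rightarrow> state \<Rightarrow> bool" where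
  "legal_round n A \<omega> G1 G2 s \<longleftrightarrow>
     (let w = chosen A \<omega> G1 G2 s; s' = inspect A \<omega> G1 G2 s; s'' = play_round A \<omega> G1 G2 s in
      fst w \<in> {1..n} - P1 s \<and>
      snd w \<in> {1..n} - P2 s \<and>
      (\<forall>v1 v2. decision A \<omega> G1 G2 s = Some (v1, v2) \<longrightarrow>
         v1 \<in> P1 s' \<and> v2 \<in> P2 s' \<and> (v1 = fst w \<or> v2 = snd w)) \<and>
      graph_iso (induced G1 (S1 s'')) (induced G2 (S2 s'')))"

definition ONLINE :: "nat \<Rightarrow> 'w online_alg set" where
  "ONLINE n =
     {A. \<forall>\<omega>. \<forall>G1\<in>graphs_on n. \<forall>G2\<in>graphs_on n. \<forall>t<n.
           legal_round n A \<omega> G1 G2 (run A \<omega> G1 G2 t)}"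

definition online_output ::
    "nat \<Rightarrow> 'w online_alg \<Rightarrow> graph \<Rightarrow> graph \<Rightarrow> 'w \<Rightarrow> graph \<times> graph" where
  "online_output n A G1 G2 \<omega> =
     (induced G1 (S1 (run A \<omega> G1 G2 n)), induced G2 (S2 (run A \<omega> G1 G2 n)))"

text \<open>For \<open>A \<in> ONLINE n\<close> both components of the output have the same number of vertices.\<close>

definition online_size :: "nat \<Rightarrow> 'w online_alg \<Rightarrow> graph \<Rightarrow> graph \<Rightarrow> 'w \<Rightarrow> nat" where
  "online_size n A G1 G2 \<omega> = card (verts (fst (online_output n A G1 G2 \<omega>)))"

end

theory Submission
  imports Defs "HOL-Real_Asymp.Real_Asymp"
begin

text \<open>
  Write \<open>k\<close> for the common size of \<open>S\<^sub>1, S\<^sub>2\<close> and \<open>X\<close> for the number of isomorphisms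
  \<open>G\<^sub>1[S\<^sub>1] \<rightarrow> G\<^sub>2[S\<^sub>2]\<close>. When a fresh vertex \<open>w\<close> is paired with a given vertex \<open>v\<close> of the other graph,
  the \<open>k\<close> edge statuses between \<open>w\<close> and the old set are still uniform. An isomorphism of the extended
  graphs is determined by the image of \<open>w\<close> and by its restriction, for which there are at most \<open>X\<close>
  choices, and it prescribes all \<open>k\<close> statuses. Hence the expected new value of \<open>X\<close> is at most
  \<open>(k + 1) 2\<^sup>-\<^sup>k X\<close>. Counting isomorphisms, instead of following one of them, pays for the freedom of
  changing the isomorphism between rounds.

  There are at most \<open>2n\<close> pairs that can be added in a round. Therefore, if \<open>k0\<close> is slightly larger
  than \<open>2 log\<^sub>2 n\<close> and \<open>q = 2n\<^sup>2 (k0 + 1) / 2 ^ k0\<close>, the potential \<open>q powi (k0 - k) * X\<close> grows by a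
  factor of at most \<open>1 + 1/n\<close> per round once \<open>k \<ge> k0\<close>, while \<open>X \<le> k0 ^ k0\<close> at \<open>k = k0\<close>. So size
  \<open>m\<close> is reached with probability at most \<open>3 k0 ^ k0 q ^ (m - k0)\<close>.
\<close>

subsection \<open>Isomorphisms and a fresh vertex\<close>

text \<open>Vertex and edge sets are separate arguments, so edges outside \<open>S\<close> are
  ignored and toggling edges leaves \<open>S\<close> alone. Membership in
  \<open>extensional S\<close> makes each isomorphism count once.\<close>

definition isos :: "'a set set \<Rightarrow> 'a set \<Rightarrow> 'b set set \<Rightarrow> 'b set \<Rightarrow> ('a \<Rightarrow> 'b) set" where
  "isos E S F T =
     {f \<in> extensional S. bij_betw f S T \<and> (\<forall>u\<in>S. \<forall>v\<in>S. {u, v} \<in> E \<longleftrightarrow> {f u, f v} \<in> F)}"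

lemma isos_subset: "isos E S F T \<subseteq> S \<rightarrow>\<^sub>E T"
  by (auto simp: isos_def bij_betw_def PiE_def)

lemma finite_isos: "finite S \<Longrightarrow> finite T \<Longrightarrow> finite (isos E S F T)"
  by (rule finite_subset[OF isos_subset]) (auto intro: finite_PiE)

lemma card_isos_le_power:
  assumes "finite S" "finite T"
  shows "card (isos E S F T) \<le> card T ^ card S"
  using card_mono[OF _ isos_subset, of S T E F] assms by (simp add: card_funcsetE finite_PiE)

lemma graph_iso_induced_iff:
  "graph_iso (induced G S) (induced H T) \<longleftrightarrow> isos (edges G) S (edges H) T \<noteq> {}"
proof
  assume "graph_iso (induced G S) (induced H T)"
  then obtain f where f: "bij_betw f S T"
    "\<forall>u\<in>S. \<forall>v\<in>S. {u, v} \<in> edges (induced G S) \<longleftrightarrow> {f u, f v} \<in> edges (induced H T)"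
    unfolding graph_iso_def by (auto simp only: induced_def verts_def fst_conv)
  have "bij_betw (restrict f S) S T"
    using f(1) by simp
  moreover have "{u, v} \<in> edges G \<longleftrightarrow> {f u, f v} \<in> edges H" if "u \<in> S" "v \<in> S" for u v
    using f that bij_betwE[OF f(1)] by (auto simp: induced_def edges_def)
  ultimately have "restrict f S \<in> isos (edges G) S (edges H) T"
    by (auto simp: isos_def)
  then show "isos (edges G) S (edges H) T \<noteq> {}" by blast
next
  assume "isos (edges G) S (edges H) T \<noteq> {}"
  then obtain f where f: "bij_betw f S T"
    "\<And>u v. u\<in>S \<Longrightarrow> v\<in>S \<Longrightarrow> {u, v} \<in> edges G \<longleftrightarrow> {f u, f v} \<in> edges H"
    by (auto simp: isos_def)
  then show "graph_iso (induced G S) (induced H T)"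
    using bij_betwE[OF f(1)]
    by (auto simp: graph_iso_def induced_def verts_def edges_def intro!: exI[of _ f])
qed

lemma isos_inverse:
  assumes "f \<in> isos E S F T"
  shows "restrict (inv_into S f) T \<in> isos F T E S"
proof -
  have f: "bij_betw f S T" "\<And>u v. u\<in>S \<Longrightarrow> v\<in>S \<Longrightarrow> {u, v} \<in> E \<longleftrightarrow> {f u, f v} \<in> F"
    using assms by (auto simp: isos_def)
  have g: "bij_betw (inv_into S f) T S"
    by (rule bij_betw_inv_into[OF f(1)])
  have "bij_betw (restrict (inv_into S f) T) T S"
    using g by simp
  moreover have "{u, v} \<in> F \<longleftrightarrow> {inv_into S f u, inv_into S f v} \<in> E" if "u \<in> T" "v \<in> T" for u v
    using f(2)[of "inv_into S f u" "inv_into S f v"] that bij_betwE[OF g]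
      bij_betw_inv_into_right[OF f(1)] by simp
  ultimately show ?thesis by (auto simp: isos_def)
qed

lemma isos_compose:
  assumes "f \<in> isos E S F T" "g \<in> isos F T H U"
  shows "compose S g f \<in> isos E S H U"
proof -
  have f: "bij_betw f S T" "\<And>u v. u\<in>S \<Longrightarrow> v\<in>S \<Longrightarrow> {u, v} \<in> E \<longleftrightarrow> {f u, f v} \<in> F"
    using assms by (auto simp: isos_def)
  have g: "bij_betw g T U" "\<And>u v. u\<in>T \<Longrightarrow> v\<in>T \<Longrightarrow> {u, v} \<in> F \<longleftrightarrow> {g u, g v} \<in> H"
    using assms by (auto simp: isos_def)
  have "bij_betw (compose S g f) S U"
    using bij_betw_trans[OF f(1) g(1)] by (simp add: compose_def o_def)
  then show ?thesis
    using f(2) g(2) bij_betwE[OF f(1)] by (auto simp: isos_def compose_def)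
qed

text \<open>If an isomorphism onto \<open>T\<close> exists, its inverse followed by one onto
  \<open>U\<close> is a fixed isomorphism from \<open>T\<close> to \<open>U\<close>, and composing
  with it is injective. Only an inequality results, since there may be no isomorphism onto
  \<open>T\<close>.\<close>

lemma card_isos_le:
  assumes "finite S" "finite T" "finite U" "isos E S H U \<noteq> {}"
  shows "card (isos E S F T) \<le> card (isos E S H U)"
proof (cases "isos E S F T = {}")
  case False
  then obtain f h where f: "f \<in> isos E S F T" and h: "h \<in> isos E S H U"
    using assms by auto
  obtain g where g: "g \<in> isos F T H U"
    using isos_compose[OF isos_inverse[OF f] h] by blast
  have "inj_on (compose S g) (isos E S F T)"
  proof (rule inj_onI)
    fix a b assume ab: "a \<in> isos E S F T" "b \<in> isos E S F T" "compose S g a = compose S g b"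
    have "a x = b x" if "x \<in> S" for x
    proof -
      have "g (a x) = g (b x)"
        using ab(3) that by (metis compose_eq)
      moreover have "a x \<in> T" "b x \<in> T" "inj_on g T"
        using ab g that by (auto simp: isos_def bij_betw_def)
      ultimately show ?thesis by (metis inj_onD)
    qed
    then show "a = b"
      using ab by (intro extensionalityI[of a S b]) (auto simp: isos_def)
  qed
  then show ?thesis
    using assms isos_compose[OF _ g] by (intro card_inj_on_le[of "compose S g"] finite_isos) auto
qed auto

text \<open>Taking inverses is injective in both directions. This lets a fresh vertex of the second
  graph be treated like one of the first.\<close>

lemma card_isos_commute:
  assumes "finite S" "finite T"
  shows "card (isos E S F T) = card (isos F T E S)"
proof -
  \<comment> \<open>The fresh type variables allow a second use with the two sides
    exchanged.\<close>
  have *: "card (isos E S F T) \<le> card (isos F T E S)"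
    if "finite S" "finite T" for E F and S :: "'c set" and T :: "'d set"
  proof (rule card_inj_on_le)
    show "inj_on (\<lambda>f. restrict (inv_into S f) T) (isos E S F T)"
    proof (rule inj_onI)
      fix a b assume ab: "a \<in> isos E S F T" "b \<in> isos E S F T"
        "restrict (inv_into S a) T = restrict (inv_into S b) T"
      have "a x = b x" if "x \<in> S" for x
      proof -
        have A: "bij_betw a S T" "bij_betw b S T" using ab by (auto simp: isos_def)
        have "a x \<in> T" using A that by (auto simp: bij_betw_def)
        then have "inv_into S b (a x) = x"
          using fun_cong[OF ab(3), of "a x"] bij_betw_inv_into_left[OF A(1) that] by simp
        then show ?thesis
          using bij_betw_inv_into_right[OF A(2) \<open>a x \<in> T\<close>] by simp
      qed
      then show "a = b"
        using ab by (intro extensionalityI[of a S b]) (auto simp: isos_def)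
    qed
  qed (use that isos_inverse in \<open>auto intro: finite_isos\<close>)
  show ?thesis using *[OF assms, of E F] *[OF assms(2,1), of F E] by simp
qed

section \<open>Averaging over the unrevealed edges at a fresh vertex\<close>

text \<open>Toggling within \<open>B G\<close> does not change \<open>B G\<close>, so averaging over
  these toggles preserves the total. With \<open>B G\<close> a set of unrevealed edges this is the
  principle of deferred decisions for the uniform distribution.\<close>

lemma toggle_average:
  fixes f :: "'a set \<Rightarrow> real"
  assumes "finite V" and BV: "\<And>G. G \<subseteq> V \<Longrightarrow> B G \<subseteq> V"
    and inv: "\<And>G E. G \<subseteq> V \<Longrightarrow> E \<subseteq> B G \<Longrightarrow> B (sym_diff G E) = B G"
  shows "(\<Sum>G\<in>Pow V. f G) = (\<Sum>G\<in>Pow V. (\<Sum>E\<in>Pow (B G). f (sym_diff G E)) / 2 ^ card (B G))"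
proof -
  define T where "T = (SIGMA G:Pow V. Pow (B G))"
  define h :: "'a set \<times> 'a set \<Rightarrow> _" where "h = (\<lambda>(G, E). (sym_diff G E, E))"
  have fin: "finite (B G)" if "G \<in> Pow V" for G
    using assms(1) BV that by (meson PowD finite_subset)
  \<comment> \<open>Toggling twice by the same \<open>E\<close> restores \<open>G\<close>, so
    \<open>h\<close> is an involution of \<open>T\<close>; reindexing by it removes the toggle from
    the argument of \<open>f\<close>.\<close>
  have hT: "h x \<in> T" "h (h x) = x" if "x \<in> T" for x
    using that BV inv by (auto simp: T_def h_def split: prod.splits) blast+
  have "(\<Sum>G\<in>Pow V. (\<Sum>E\<in>Pow (B G). f (sym_diff G E)) / 2 ^ card (B G))
      = (\<Sum>(G, E)\<in>T. f (sym_diff G E) / 2 ^ card (B G))"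
    unfolding T_def using assms(1) fin by (subst sum.Sigma[symmetric]) (auto simp: sum_divide_distrib)
  also have "\<dots> = (\<Sum>(G, E)\<in>T. f G / 2 ^ card (B G))"
    by (rule sum.reindex_bij_witness[of _ h h]) (use hT inv in \<open>auto simp: h_def T_def\<close>)
  also have "\<dots> = (\<Sum>G\<in>Pow V. \<Sum>E\<in>Pow (B G). f G / 2 ^ card (B G))"
    unfolding T_def using assms(1) fin by (subst sum.Sigma[symmetric]) auto
  also have "\<dots> = (\<Sum>G\<in>Pow V. f G)"
    using fin by (intro sum.cong) (auto simp: card_Pow)
  finally show ?thesis ..
qed

lemma isos_insert_restrict:
  assumes "f \<in> isos E (insert w S) F T" "w \<notin> S"
  shows "restrict f S \<in> isos E S F (T - {f w})"
proof -
  have f: "bij_betw f (insert w S) T"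
    "\<And>u v. u\<in>insert w S \<Longrightarrow> v\<in>insert w S \<Longrightarrow> {u, v} \<in> E \<longleftrightarrow> {f u, f v} \<in> F"
    using assms by (auto simp: isos_def)
  have "bij_betw f S (T - {f w})"
    using f(1) assms(2) by (auto simp: bij_betw_def inj_on_def)
  then have "bij_betw (restrict f S) S (T - {f w})"
    by simp
  then show ?thesis using f(2) by (auto simp: isos_def)
qed

text \<open>A bijection determines the set \<open>D\<close> of toggled edges at the new vertex \<open>w\<close>, and its restriction
  to \<open>S\<close> does not involve those edges.\<close>

lemma sum_toggle_star_card_isos:
  fixes E :: "nat set set"
  assumes fin: "finite S" "finite T" and "card S = card T" and w: "w \<notin> S" and v: "v \<notin> T"
    and ne: "isos E S F T \<noteq> {}"
  shows "(\<Sum>D\<in>Pow ((\<lambda>x. {w, x}) ` S). card (isos (sym_diff E D) (insert w S) F (insert v T)))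
       \<le> (card S + 1) * card (isos E S F T)"
proof -
  define B where "B = (\<lambda>x. {w, x}) ` S"
  define Q where "Q = (SIGMA D:Pow B. isos (sym_diff E D) (insert w S) F (insert v T))"
  \<comment> \<open>Here \<open>y\<close> is the image of \<open>w\<close>, so that \<open>S\<close>
    has to be mapped onto the remaining vertices.\<close>
  define R where "R = (SIGMA y:insert v T. isos E S F (insert v T - {y}))"
  define h where "h = (\<lambda>(D :: nat set set, f :: nat \<Rightarrow> 'a). (f w, restrict f S))"
  have "inj_on h Q"
  proof (rule inj_onI)
    fix a b assume a: "a \<in> Q" and b: "b \<in> Q" and ab: "h a = h b"
    obtain D f where af: "a = (D, f)" by fastforce
    obtain D' g where bg: "b = (D', g)" by fastforce
    have f: "f \<in> isos (sym_diff E D) (insert w S) F (insert v T)" "D \<subseteq> B"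
      using a af by (auto simp: Q_def)
    have g: "g \<in> isos (sym_diff E D') (insert w S) F (insert v T)" "D' \<subseteq> B"
      using b bg by (auto simp: Q_def)
    have "f x = g x" if "x \<in> insert w S" for x
      using ab af bg that by (auto simp: h_def dest: fun_cong[where x = x])
    then have fg: "f = g"
      using f g by (intro extensionalityI[of f "insert w S" g]) (auto simp: isos_def)
    have "{w, x} \<in> D \<longleftrightarrow> {w, x} \<in> D'" if "x \<in> S" for x
    proof -
      have "{w, x} \<in> sym_diff E D \<longleftrightarrow> {w, x} \<in> sym_diff E D'"
        using f(1) g(1) fg that unfolding isos_def by blast
      then show ?thesis by blast
    qed
    then have "D = D'" using f(2) g(2) by (auto simp: B_def)
    then show "a = b" using fg af bg by simp
  qed
  moreover have "h ` Q \<subseteq> R"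
  proof
    fix z assume "z \<in> h ` Q"
    then obtain D f where z: "z = (f w, restrict f S)" and D: "D \<subseteq> B"
      and f: "f \<in> isos (sym_diff E D) (insert w S) F (insert v T)"
      by (auto simp: Q_def h_def)
    have "restrict f S \<in> isos (sym_diff E D) S F (insert v T - {f w})"
      by (rule isos_insert_restrict[OF f w])
    moreover have "{x, y} \<in> sym_diff E D \<longleftrightarrow> {x, y} \<in> E" if "x \<in> S" "y \<in> S" for x y
      using D w that by (auto simp: B_def)
    ultimately have "restrict f S \<in> isos E S F (insert v T - {f w})"
      by (simp add: isos_def)
    moreover have "f w \<in> insert v T"
      using f by (auto simp: isos_def bij_betw_def)
    ultimately show "z \<in> R" by (auto simp: R_def z)
  qed
  moreover have "finite R"
    unfolding R_def using fin by (intro finite_SigmaI finite_isos) auto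
  ultimately have "card Q \<le> card R" by (rule card_inj_on_le)
  also have "card R = (\<Sum>y\<in>insert v T. card (isos E S F (insert v T - {y})))"
    unfolding R_def using fin by (intro card_SigmaI) (auto intro: finite_isos)
  \<comment> \<open>Since isomorphisms onto \<open>T\<close> exist, no other target set admits more
    of them.\<close>
  also have "\<dots> \<le> (\<Sum>y\<in>insert v T. card (isos E S F T))"
    using fin ne by (intro sum_mono card_isos_le) auto
  also have "\<dots> = (card S + 1) * card (isos E S F T)"
    using fin v assms(3) by simp
  also have "card Q = (\<Sum>D\<in>Pow B. card (isos (sym_diff E D) (insert w S) F (insert v T)))"
    unfolding Q_def using fin by (intro card_SigmaI) (auto intro!: finite_isos simp: B_def)
  finally show ?thesis unfolding B_def .
qed

text \<open>For each partner \<open>v\<close>, averaging over the star from \<open>w E\<close> to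
  \<open>S E\<close> gives the factor \<open>(k + 1) / 2 ^ k\<close>, where
  \<open>k = card (S E)\<close>; the sum over partners costs at most \<open>card C\<close>. The
  assumption \<open>inv\<close> says that the sets and the fresh vertex were chosen without
  knowledge of that star. The weight of the potential enters through \<open>h\<close>.\<close>

lemma sum_fresh_vertex_isos:
  fixes S T :: "nat set set \<Rightarrow> nat set" and w :: "nat set set \<Rightarrow> nat" and h :: "nat \<Rightarrow> real"
  assumes "finite V" "finite C" and h: "\<And>k. h k \<ge> 0"
    and inv: "\<And>E D. E \<subseteq> V \<Longrightarrow> D \<subseteq> (\<lambda>x. {w E, x}) ` S E \<Longrightarrow>
        S (sym_diff E D) = S E \<and> T (sym_diff E D) = T E \<and> w (sym_diff E D) = w E"
    and star: "\<And>E. E \<subseteq> V \<Longrightarrow> (\<lambda>x. {w E, x}) ` S E \<subseteq> V"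
    and fresh: "\<And>E. E \<subseteq> V \<Longrightarrow> w E \<notin> S E"
    and fin: "\<And>E. E \<subseteq> V \<Longrightarrow> finite (S E) \<and> finite (T E) \<and> card (S E) = card (T E)"
    and ne: "\<And>E. E \<subseteq> V \<Longrightarrow> isos E (S E) F (T E) \<noteq> {}"
  shows "(\<Sum>E\<in>Pow V. h (card (S E)) *
            (\<Sum>v\<in>C - T E. real (card (isos E (insert (w E) (S E)) F (insert v (T E))))))
       \<le> (\<Sum>E\<in>Pow V. h (card (S E)) * card C * (card (S E) + 1) / 2 ^ card (S E)
              * card (isos E (S E) F (T E)))"
    (is "(\<Sum>E\<in>Pow V. ?f E) \<le> _")
proof -
  define B where "B = (\<lambda>E. (\<lambda>x. {w E, x}) ` S E)"
  have cardB: "card (B E) = card (S E)" if "E \<subseteq> V" for E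
    unfolding B_def using fresh[OF that]
    by (intro card_image inj_onI) (metis doubleton_eq_iff)
  have "(\<Sum>E\<in>Pow V. ?f E) = (\<Sum>E\<in>Pow V. (\<Sum>D\<in>Pow (B E). ?f (sym_diff E D)) / 2 ^ card (B E))"
    using assms(1) star inv by (intro toggle_average) (auto simp: B_def)
  also have "\<dots> \<le> (\<Sum>E\<in>Pow V. h (card (S E)) * card C * (card (S E) + 1) / 2 ^ card (S E)
              * card (isos E (S E) F (T E)))"
  proof (rule sum_mono)
    fix E assume "E \<in> Pow V"
    then have E: "E \<subseteq> V" by simp
    define X where "X = real (card (isos E (S E) F (T E)))"
    define g where "g = (\<lambda>v D. real (card (isos (sym_diff E D) (insert (w E) (S E)) F (insert v (T E)))))"
    have g: "(\<Sum>D\<in>Pow (B E). g v D) \<le> (card (S E) + 1) * X" if "v \<in> C - T E" for v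
    proof -
      have "(\<Sum>D\<in>Pow (B E). card (isos (sym_diff E D) (insert (w E) (S E)) F (insert v (T E))))
          \<le> (card (S E) + 1) * card (isos E (S E) F (T E))"
        unfolding B_def using fin[OF E] fresh[OF E] ne[OF E] that
        by (intro sum_toggle_star_card_isos) auto
      then show ?thesis
        unfolding g_def X_def of_nat_sum[symmetric] of_nat_mult[symmetric] by (simp only: of_nat_le_iff)
    qed
    have "(\<Sum>D\<in>Pow (B E). ?f (sym_diff E D))
        = (\<Sum>D\<in>Pow (B E). h (card (S E)) * (\<Sum>v\<in>C - T E. g v D))"
      using inv[OF E] by (intro sum.cong refl) (simp add: B_def g_def)
    also have "\<dots> = h (card (S E)) * (\<Sum>v\<in>C - T E. \<Sum>D\<in>Pow (B E). g v D)"
      by (simp add: sum_distrib_left[symmetric] sum.swap[of _ "Pow (B E)"])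
    also have "\<dots> \<le> h (card (S E)) * (\<Sum>v\<in>C - T E. (card (S E) + 1) * X)"
      by (intro mult_left_mono sum_mono g h) auto
    also have "\<dots> = h (card (S E)) * (card (C - T E) * ((card (S E) + 1) * X))"
      by simp
    also have "\<dots> \<le> h (card (S E)) * (card C * ((card (S E) + 1) * X))"
      using assms(2) h by (intro mult_left_mono mult_right_mono) (auto simp: X_def intro: card_mono)
    finally have "(\<Sum>D\<in>Pow (B E). ?f (sym_diff E D)) / 2 ^ card (B E)
        \<le> h (card (S E)) * (card C * ((card (S E) + 1) * X)) / 2 ^ card (S E)"
      unfolding cardB[OF E] by (intro divide_right_mono) auto
    then show "(\<Sum>D\<in>Pow (B E). ?f (sym_diff E D)) / 2 ^ card (B E)
        \<le> h (card (S E)) * card C * (card (S E) + 1) / 2 ^ card (S E) * card (isos E (S E) F (T E))"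
      by (simp add: X_def algebra_simps)
  qed
  finally show ?thesis .
qed

subsection \<open>Online play\<close>

lemma finite_vertex_pairs: "finite (vertex_pairs n)"
  by (rule finite_subset[of _ "Pow {1..n}"]) (auto simp: vertex_pairs_def)

lemma induced_mono_cong: "induced G S = induced H S \<Longrightarrow> T \<subseteq> S \<Longrightarrow> induced G T = induced H T"
  by (auto simp: induced_def set_eq_iff)

lemma P_play_round:
  "P1 (play_round A \<omega> G1 G2 s) = insert (fst (chosen A \<omega> G1 G2 s)) (P1 s)"
  "P2 (play_round A \<omega> G1 G2 s) = insert (snd (chosen A \<omega> G1 G2 s)) (P2 s)"
  by (auto simp: play_round_def inspect_def Let_def split: option.splits)

lemma P_inspect:
  "P1 (inspect A \<omega> G1 G2 s) = insert (fst (chosen A \<omega> G1 G2 s)) (P1 s)"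
  "P2 (inspect A \<omega> G1 G2 s) = insert (snd (chosen A \<omega> G1 G2 s)) (P2 s)"
  by (auto simp: inspect_def)

lemma chosen_cong:
  assumes "induced G1 (P1 s) = induced H1 (P1 s)" "induced G2 (P2 s) = induced H2 (P2 s)"
  shows "chosen A \<omega> H1 H2 s = chosen A \<omega> G1 G2 s"
  using assms by (simp add: chosen_def view_of_def)

text \<open>Inspected sets only grow and each choice is a function of the view, so agreement on the
  sets inspected by round \<open>t\<close> carries over to all earlier rounds.\<close>

lemma run_cong:
  assumes "induced G1 (P1 (run A \<omega> G1 G2 t)) = induced H1 (P1 (run A \<omega> G1 G2 t))"
    and "induced G2 (P2 (run A \<omega> G1 G2 t)) = induced H2 (P2 (run A \<omega> G1 G2 t))"
  shows "run A \<omega> H1 H2 t = run A \<omega> G1 G2 t"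
  using assms
proof (induction t)
  case (Suc t)
  define s where "s = run A \<omega> G1 G2 t"
  have eq: "induced G1 (insert (fst (chosen A \<omega> G1 G2 s)) (P1 s)) =
        induced H1 (insert (fst (chosen A \<omega> G1 G2 s)) (P1 s))"
      "induced G2 (insert (snd (chosen A \<omega> G1 G2 s)) (P2 s)) =
        induced H2 (insert (snd (chosen A \<omega> G1 G2 s)) (P2 s))"
    using Suc.prems by (simp_all add: s_def P_play_round)
  have eq': "induced G1 (P1 s) = induced H1 (P1 s)" "induced G2 (P2 s) = induced H2 (P2 s)"
    by (rule induced_mono_cong[OF eq(1)] induced_mono_cong[OF eq(2)]; blast)+
  have "chosen A \<omega> H1 H2 s = chosen A \<omega> G1 G2 s"
    by (rule chosen_cong[OF eq'])
  moreover from this have ins: "inspect A \<omega> H1 H2 s = inspect A \<omega> G1 G2 s"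
    by (simp add: inspect_def)
  \<comment> \<open>The decision also sees the edges at the newly inspected vertices, so agreement
    on the enlarged sets is required here.\<close>
  moreover have "view_of H1 H2 (inspect A \<omega> G1 G2 s) = view_of G1 G2 (inspect A \<omega> G1 G2 s)"
    using eq by (simp add: view_of_def P_inspect)
  ultimately have "decision A \<omega> H1 H2 s = decision A \<omega> G1 G2 s"
    by (simp add: decision_def)
  then have "play_round A \<omega> H1 H2 s = play_round A \<omega> G1 G2 s"
    by (simp add: play_round_def ins)
  moreover have "run A \<omega> H1 H2 t = s"
    unfolding s_def using eq' by (intro Suc.IH) (simp_all add: s_def)
  ultimately show ?case by (simp add: s_def)
qed auto

lemma induced_toggle_outside:
  assumes "\<And>e. e \<in> D \<Longrightarrow> \<not> e \<subseteq> P"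
  shows "induced (W, E) P = induced (W, sym_diff E D) P"
  using assms by (auto simp: induced_def edges_def)

text \<open>The factor \<open>(k + 1) / 2 ^ k\<close> decreases in \<open>k\<close>, and
  \<open>q\<close> is chosen so that \<open>n\<close> times its value at \<open>k0\<close> is
  \<open>q / (2 * n)\<close>. The additional weight \<open>1 / q\<close> of a larger set cancels
  \<open>q\<close> and leaves \<open>1 / (2 * n)\<close>.\<close>

lemma weight_step_le:
  fixes q :: real
  assumes "0 < n" "0 < k0" "k0 \<le> k" "q = 2 * real n ^ 2 * (real k0 + 1) / 2 ^ k0"
  shows "(1 / q) ^ (k + 1 - k0) * real n * (real k + 1) / 2 ^ k \<le> (1 / q) ^ (k - k0) / (2 * real n)"
proof -
  have q: "q > 0" using assms by simp
  have "(real k + 1) / 2 ^ k \<le> (real k0 + 1) / 2 ^ k0"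
    using assms(3)
  proof (induction k rule: dec_induct)
    case (step k)
    have "(real (Suc k) + 1) / 2 ^ Suc k = (real k / 2 + 1) / 2 ^ k"
      by (simp add: field_simps)
    also have "\<dots> \<le> (real k + 1) / 2 ^ k"
      by (intro divide_right_mono) auto
    finally show ?case using step by simp
  qed simp
  also have "\<dots> = q / (2 * real n ^ 2)"
    using assms by (simp add: field_simps)
  finally have "(1 / q) ^ (k - k0) * (1 / q) * real n * ((real k + 1) / 2 ^ k)
      \<le> (1 / q) ^ (k - k0) * (1 / q) * real n * (q / (2 * real n ^ 2))"
    using q by (intro mult_left_mono) auto
  also have "\<dots> = (1 / q) ^ (k - k0) / (2 * real n)"
    using q assms(1) by (simp add: field_simps power2_eq_square)
  finally show ?thesis
    using assms(3) by (simp add: Suc_diff_le algebra_simps)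
qed

section \<open>Runs of a fixed algorithm as functions of the two edge sets\<close>

locale online_play =
  fixes n :: nat and A :: "'w online_alg" and \<omega> :: 'w
  assumes online: "A \<in> ONLINE n"
begin

text \<open>With edge sets as arguments, toggling edges is a symmetric difference and probabilities
  become counts over \<open>Pow (vertex_pairs n)\<close>.\<close>

definition state_at :: "nat \<Rightarrow> nat set set \<Rightarrow> nat set set \<Rightarrow> state" where
  "state_at t E F = run A \<omega> ({1..n}, E) ({1..n}, F) t"

text \<open>These vertices are inspected in round \<open>t + 1\<close>, as \<open>state_at t\<close>
  is the state at the end of round \<open>t\<close>.\<close>

definition pick :: "nat \<Rightarrow> nat set set \<Rightarrow> nat set set \<Rightarrow> nat \<times> nat" where
  "pick t E F = chosen A \<omega> ({1..n}, E) ({1..n}, F) (state_at t E F)"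

lemma legal:
  assumes "E \<subseteq> vertex_pairs n" "F \<subseteq> vertex_pairs n" "t < n"
  shows "legal_round n A \<omega> ({1..n}, E) ({1..n}, F) (state_at t E F)"
proof -
  have "({1..n}, E) \<in> graphs_on n" "({1..n}, F) \<in> graphs_on n"
    using assms by (auto simp: graphs_on_def verts_def edges_def)
  then show ?thesis using online assms(3) by (auto simp: ONLINE_def state_at_def)
qed

lemma pick_fresh:
  assumes "E \<subseteq> vertex_pairs n" "F \<subseteq> vertex_pairs n" "t < n"
  shows "fst (pick t E F) \<in> {1..n} - P1 (state_at t E F)"
    and "snd (pick t E F) \<in> {1..n} - P2 (state_at t E F)"
  using legal[OF assms] by (auto simp: legal_round_def pick_def Let_def)

lemma state_at_Suc_cases:
  assumes "E \<subseteq> vertex_pairs n" "F \<subseteq> vertex_pairs n" "t < n"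
  obtains
    (keep) "S1 (state_at (Suc t) E F) = S1 (state_at t E F)"
      "S2 (state_at (Suc t) E F) = S2 (state_at t E F)"
  | (extend) v1 v2 where
      "S1 (state_at (Suc t) E F) = insert v1 (S1 (state_at t E F))"
      "S2 (state_at (Suc t) E F) = insert v2 (S2 (state_at t E F))"
      "v1 \<in> P1 (state_at (Suc t) E F)" "v2 \<in> P2 (state_at (Suc t) E F)"
      "v1 = fst (pick t E F) \<or> v2 = snd (pick t E F)"
proof (cases "decision A \<omega> ({1..n}, E) ({1..n}, F) (state_at t E F)")
  case None
  then show ?thesis
    by (intro keep) (simp_all add: state_at_def play_round_def inspect_def Let_def)
next
  case (Some v)
  then obtain v1 v2 where
    v: "decision A \<omega> ({1..n}, E) ({1..n}, F) (state_at t E F) = Some (v1, v2)"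
    by (cases v) auto
  then have *: "v1 \<in> P1 (inspect A \<omega> ({1..n}, E) ({1..n}, F) (state_at t E F))"
    "v2 \<in> P2 (inspect A \<omega> ({1..n}, E) ({1..n}, F) (state_at t E F))"
    "v1 = fst (pick t E F) \<or> v2 = snd (pick t E F)"
    using legal[OF assms] by (auto simp: legal_round_def pick_def Let_def)
  show ?thesis
    using v * by (intro extend[of v1 v2])
      (auto simp: state_at_def play_round_def inspect_def Let_def)
qed

lemma state_at_invariant:
  assumes "E \<subseteq> vertex_pairs n" "F \<subseteq> vertex_pairs n" "t \<le> n"
  shows "S1 (state_at t E F) \<subseteq> P1 (state_at t E F) \<and> P1 (state_at t E F) \<subseteq> {1..n} \<and>
    S2 (state_at t E F) \<subseteq> P2 (state_at t E F) \<and> P2 (state_at t E F) \<subseteq> {1..n} \<and>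
    isos E (S1 (state_at t E F)) F (S2 (state_at t E F)) \<noteq> {}"
  using assms(3)
proof (induction t)
  case 0
  show ?case by (auto simp: state_at_def isos_def bij_betw_def)
next
  case (Suc t)
  then have t: "t < n" by simp
  have P: "P1 (state_at (Suc t) E F) = insert (fst (pick t E F)) (P1 (state_at t E F))"
    "P2 (state_at (Suc t) E F) = insert (snd (pick t E F)) (P2 (state_at t E F))"
    by (simp_all add: state_at_def pick_def P_play_round)
  have "graph_iso (induced ({1..n}, E) (S1 (state_at (Suc t) E F)))
      (induced ({1..n}, F) (S2 (state_at (Suc t) E F)))"
    using legal[OF assms(1,2) t] by (simp add: legal_round_def Let_def state_at_def)
  then have "isos E (S1 (state_at (Suc t) E F)) F (S2 (state_at (Suc t) E F)) \<noteq> {}"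
    by (simp add: graph_iso_induced_iff edges_def)
  then show ?case
    using Suc pick_fresh[OF assms(1,2) t] P
    by (cases rule: state_at_Suc_cases[OF assms(1,2) t]) auto
qed

lemma state_at_finite:
  assumes "E \<subseteq> vertex_pairs n" "F \<subseteq> vertex_pairs n" "t \<le> n"
  shows "finite (S1 (state_at t E F)) \<and> finite (S2 (state_at t E F)) \<and>
    card (S1 (state_at t E F)) = card (S2 (state_at t E F))"
proof -
  have "S1 (state_at t E F) \<subseteq> {1..n}" "S2 (state_at t E F) \<subseteq> {1..n}"
    using state_at_invariant[OF assms] by auto
  moreover obtain f where "bij_betw f (S1 (state_at t E F)) (S2 (state_at t E F))"
    using state_at_invariant[OF assms] by (auto simp: isos_def)
  ultimately show ?thesis
    by (metis finite_atLeastAtMost finite_subset bij_betw_same_card)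
qed

text \<open>The picked vertex lies outside the inspected set, so no edge of its star has been
  revealed when it is picked. The play so far and the pick cannot depend on these edges.\<close>

lemma star_toggle_invariant:
  assumes "E \<subseteq> vertex_pairs n" "F \<subseteq> vertex_pairs n" "t < n"
  shows "D \<subseteq> (\<lambda>x. {fst (pick t E F), x}) ` S1 (state_at t E F) \<Longrightarrow>
      state_at t (sym_diff E D) F = state_at t E F \<and> pick t (sym_diff E D) F = pick t E F"
    and "D \<subseteq> (\<lambda>x. {snd (pick t E F), x}) ` S2 (state_at t E F) \<Longrightarrow>
      state_at t E (sym_diff F D) = state_at t E F \<and> pick t E (sym_diff F D) = pick t E F"
proof -
  assume D: "D \<subseteq> (\<lambda>x. {fst (pick t E F), x}) ` S1 (state_at t E F)"
  have eq: "induced ({1..n}, E) (P1 (state_at t E F)) = induced ({1..n}, sym_diff E D) (P1 (state_at t E F))"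
    by (rule induced_toggle_outside) (use D pick_fresh[OF assms] in auto)
  have "state_at t (sym_diff E D) F = state_at t E F"
    unfolding state_at_def by (rule run_cong[OF _ refl]) (rule eq[unfolded state_at_def])
  then show "state_at t (sym_diff E D) F = state_at t E F \<and> pick t (sym_diff E D) F = pick t E F"
    using chosen_cong[OF eq refl] by (simp add: pick_def)
next
  assume D: "D \<subseteq> (\<lambda>x. {snd (pick t E F), x}) ` S2 (state_at t E F)"
  have eq: "induced ({1..n}, F) (P2 (state_at t E F)) = induced ({1..n}, sym_diff F D) (P2 (state_at t E F))"
    by (rule induced_toggle_outside) (use D pick_fresh[OF assms] in auto)
  have "state_at t E (sym_diff F D) = state_at t E F"
    unfolding state_at_def by (rule run_cong[OF refl]) (rule eq[unfolded state_at_def])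
  then show "state_at t E (sym_diff F D) = state_at t E F \<and> pick t E (sym_diff F D) = pick t E F"
    using chosen_cong[OF refl eq] by (simp add: pick_def)
qed

lemma star_subset_vertex_pairs:
  assumes "E \<subseteq> vertex_pairs n" "F \<subseteq> vertex_pairs n" "t < n"
  shows "(\<lambda>x. {fst (pick t E F), x}) ` S1 (state_at t E F) \<subseteq> vertex_pairs n"
    and "(\<lambda>x. {snd (pick t E F), x}) ` S2 (state_at t E F) \<subseteq> vertex_pairs n"
proof -
  have *: "(\<lambda>x. {w, x}) ` S \<subseteq> vertex_pairs n"
    if "w \<in> {1..n} - P" "S \<subseteq> P" "P \<subseteq> {1..n}" for w :: nat and S P
    using that unfolding vertex_pairs_def card_2_iff by blast
  note inv = state_at_invariant[OF assms(1,2) less_imp_le[OF assms(3)]]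
  show "(\<lambda>x. {fst (pick t E F), x}) ` S1 (state_at t E F) \<subseteq> vertex_pairs n"
    by (rule *[OF pick_fresh(1)[OF assms]]) (use inv in simp_all)
  show "(\<lambda>x. {snd (pick t E F), x}) ` S2 (state_at t E F) \<subseteq> vertex_pairs n"
    by (rule *[OF pick_fresh(2)[OF assms]]) (use inv in simp_all)
qed

section \<open>The potential and its expected growth\<close>

text \<open>The number of isomorphisms is at most \<open>k0 ^ k0\<close> when size \<open>k0\<close> is reached, so that the
  potential does not grow up to that moment.\<close>

definition pot :: "nat \<Rightarrow> real \<Rightarrow> nat \<Rightarrow> nat set set \<Rightarrow> nat set set \<Rightarrow> real" where
  "pot k0 q t E F =
     (let S = S1 (state_at t E F) in
      if card S < k0 then real k0 ^ k0
      else (1 / q) ^ (card S - k0) * card (isos E S F (S2 (state_at t E F))))"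

text \<open>The algorithm chooses the partner of the fresh vertex after seeing its edges; summing
  over all candidates \<open>v\<close> dominates every such choice. The weight is that of the
  extended set, and 0 while extending cannot raise the potential.\<close>

definition gain1 :: "nat \<Rightarrow> real \<Rightarrow> nat \<Rightarrow> nat set set \<Rightarrow> nat set set \<Rightarrow> real" where
  "gain1 k0 q t E F =
     (let S = S1 (state_at t E F); T = S2 (state_at t E F); w = fst (pick t E F) in
      (if card S < k0 then 0 else (1 / q) ^ (card S + 1 - k0)) *
      (\<Sum>v\<in>{1..n} - T. real (card (isos E (insert w S) F (insert v T)))))"

text \<open>Isomorphisms run from the second graph to the first here, which puts the fresh vertex on
  the source side again.\<close>

definition gain2 :: "nat \<Rightarrow> real \<Rightarrow> nat \<Rightarrow> nat set set \<Rightarrow> nat set set \<Rightarrow> real" where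
  "gain2 k0 q t E F =
     (let S = S1 (state_at t E F); T = S2 (state_at t E F); w = snd (pick t E F) in
      (if card T < k0 then 0 else (1 / q) ^ (card T + 1 - k0)) *
      (\<Sum>v\<in>{1..n} - S. real (card (isos F (insert w T) E (insert v S)))))"

lemma gain_nonneg: "q > 0 \<Longrightarrow> gain1 k0 q t E F \<ge> 0" "q > 0 \<Longrightarrow> gain2 k0 q t E F \<ge> 0"
  by (auto simp: gain1_def gain2_def Let_def intro!: mult_nonneg_nonneg sum_nonneg)

text \<open>From size \<open>k0\<close> on, the new count after an extension is one summand of
  \<open>gain1\<close> or of \<open>gain2\<close>, according to which added vertex is fresh.\<close>

lemma pot_Suc_le:
  assumes "E \<subseteq> vertex_pairs n" "F \<subseteq> vertex_pairs n" "t < n" and q: "q > 0"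
  shows "pot k0 q (Suc t) E F \<le> pot k0 q t E F + gain1 k0 q t E F + gain2 k0 q t E F"
  using assms(1-3)
proof (cases rule: state_at_Suc_cases)
  case keep
  then show ?thesis using gain_nonneg[OF q, of k0 t E F] by (simp add: pot_def Let_def)
next
  case (extend v1 v2)
  define S T S' T' where "S = S1 (state_at t E F)" and "T = S2 (state_at t E F)"
    and "S' = S1 (state_at (Suc t) E F)" and "T' = S2 (state_at (Suc t) E F)"
  have t: "t \<le> n" "Suc t \<le> n" using assms by auto
  note inv = state_at_invariant[OF assms(1,2) t(1), folded S_def T_def]
    state_at_invariant[OF assms(1,2) t(2), folded S'_def T'_def]
  note fin = state_at_finite[OF assms(1,2) t(1), folded S_def T_def]
    state_at_finite[OF assms(1,2) t(2), folded S'_def T'_def]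
  have S': "S' = insert v1 S" and T': "T' = insert v2 T"
    using extend by (simp_all add: S_def T_def S'_def T'_def)
  have new: "fst (pick t E F) \<notin> S" "snd (pick t E F) \<notin> T"
    using pick_fresh[OF assms(1-3)] inv by auto
  \<comment> \<open>One added vertex is fresh, so its side grows; equal sizes before and after force
    the other side to grow too.\<close>
  have "card S' = Suc (card S)" "v1 \<notin> S" "v2 \<notin> T"
    using fin new extend(5) by (auto simp: S' T' card_insert_if split: if_splits)
  note c = this
  have v: "v1 \<in> {1..n}" "v2 \<in> {1..n}" using inv by (auto simp: S' T')
  show ?thesis
  proof (cases "card S < k0")
    case True
    \<comment> \<open>The potential can change here only on reaching size exactly \<open>k0\<close>,
      where the exponent of \<open>1 / q\<close> is 0.\<close>
    have "card (isos E S' F T') \<le> k0 ^ k0" if "card S' = k0"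
      using card_isos_le_power[of S' T' E F] fin that by simp
    then have "pot k0 q (Suc t) E F \<le> pot k0 q t E F"
      using True c(1) by (auto simp: pot_def Let_def S_def[symmetric] S'_def[symmetric] T'_def[symmetric]
          simp flip: of_nat_power)
    then show ?thesis using gain_nonneg[OF q, of k0 t E F] by simp
  next
    case False
    have pot: "pot k0 q (Suc t) E F = (1 / q) ^ (card S + 1 - k0) * card (isos E S' F T')"
      using False c(1) by (simp add: pot_def Let_def S_def[symmetric] S'_def[symmetric] T'_def[symmetric])
    have pot0: "pot k0 q t E F \<ge> 0" using q by (simp add: pot_def Let_def)
    from extend(5) show ?thesis
    proof
      assume w: "v1 = fst (pick t E F)"
      have "real (card (isos E S' F T')) \<le> (\<Sum>v\<in>{1..n} - T. real (card (isos E S' F (insert v T))))"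
        unfolding T' using v c by (intro member_le_sum) auto
      then have "pot k0 q (Suc t) E F \<le> gain1 k0 q t E F"
        unfolding pot gain1_def Let_def S_def[symmetric] T_def[symmetric] w[symmetric] S'[symmetric]
        using False q by (simp add: mult_left_mono)
      then show ?thesis using gain_nonneg[OF q, of k0 t E F] pot0 by simp
    next
      assume w: "v2 = snd (pick t E F)"
      have "real (card (isos E S' F T')) = card (isos F T' E S')"
        using fin card_isos_commute[of S' T' E F] by simp
      also have "\<dots> \<le> (\<Sum>v\<in>{1..n} - S. real (card (isos F T' E (insert v S))))"
        unfolding S' using v c by (intro member_le_sum) auto
      finally have "pot k0 q (Suc t) E F \<le> gain2 k0 q t E F"
        unfolding pot gain2_def Let_def S_def[symmetric] T_def[symmetric] w[symmetric] T'[symmetric]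
        using False q fin by (simp add: mult_left_mono)
      then show ?thesis using gain_nonneg[OF q, of k0 t E F] pot0 by simp
    qed
  qed
qed

text \<open>The average is taken over the graph containing the fresh vertex, with the other graph
  fixed. Each kind of gain amounts to at most a fraction \<open>1 / (2 * n)\<close> of the
  potential.\<close>

lemma sum_gain_le:
  assumes "t < n" "0 < k0" and q: "q = 2 * real n ^ 2 * (real k0 + 1) / 2 ^ k0"
  shows "F \<subseteq> vertex_pairs n \<Longrightarrow>
      (\<Sum>E\<in>Pow (vertex_pairs n). gain1 k0 q t E F) \<le> (\<Sum>E\<in>Pow (vertex_pairs n). pot k0 q t E F) / (2 * n)"
    and "E \<subseteq> vertex_pairs n \<Longrightarrow>
      (\<Sum>F\<in>Pow (vertex_pairs n). gain2 k0 q t E F) \<le> (\<Sum>F\<in>Pow (vertex_pairs n). pot k0 q t E F) / (2 * n)"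
proof -
  have qpos: "q > 0" using assms by simp
  define h where "h = (\<lambda>k. if k < k0 then 0 else (1 / q) ^ (k + 1 - k0))"
  have h0: "h k \<ge> 0" for k using qpos by (simp add: h_def)
  have hk: "h k * card {1..n} * (k + 1) / 2 ^ k * x
      \<le> (if k < k0 then real k0 ^ k0 else (1 / q) ^ (k - k0) * x) / (2 * n)" if "x \<ge> 0" for k x
  proof (cases "k < k0")
    case False
    have "(1 / q) ^ (k + 1 - k0) * real n * (real k + 1) / 2 ^ k \<le> (1 / q) ^ (k - k0) / (2 * real n)"
      using assms(1) False by (intro weight_step_le[OF _ assms(2) _ q]) auto
    from mult_right_mono[OF this that] show ?thesis
      using False by (simp add: h_def add.commute)
  qed (simp add: h_def)
  show "(\<Sum>E\<in>Pow (vertex_pairs n). gain1 k0 q t E F) \<le> (\<Sum>E\<in>Pow (vertex_pairs n). pot k0 q t E F) / (2 * n)"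
    if F: "F \<subseteq> vertex_pairs n"
  proof -
    let ?S = "\<lambda>E. S1 (state_at t E F)" and ?T = "\<lambda>E. S2 (state_at t E F)" and ?w = "\<lambda>E. fst (pick t E F)"
    have "(\<Sum>E\<in>Pow (vertex_pairs n). h (card (?S E)) *
            (\<Sum>v\<in>{1..n} - ?T E. real (card (isos E (insert (?w E) (?S E)) F (insert v (?T E))))))
       \<le> (\<Sum>E\<in>Pow (vertex_pairs n). h (card (?S E)) * card {1..n} * (card (?S E) + 1) / 2 ^ card (?S E)
              * card (isos E (?S E) F (?T E)))"
    proof (rule sum_fresh_vertex_isos[OF finite_vertex_pairs _ h0])
      fix E assume E: "E \<subseteq> vertex_pairs n"
      note inv = state_at_invariant[OF E F less_imp_le[OF assms(1)]]
      show "isos E (?S E) F (?T E) \<noteq> {}" using inv by auto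
      show "?w E \<notin> ?S E" using pick_fresh[OF E F assms(1)] inv by auto
      show "(\<lambda>x. {?w E, x}) ` ?S E \<subseteq> vertex_pairs n" by (rule star_subset_vertex_pairs[OF E F assms(1)])
      show "finite (?S E) \<and> finite (?T E) \<and> card (?S E) = card (?T E)"
        by (rule state_at_finite[OF E F less_imp_le[OF assms(1)]])
      fix D assume "D \<subseteq> (\<lambda>x. {?w E, x}) ` ?S E"
      then show "?S (sym_diff E D) = ?S E \<and> ?T (sym_diff E D) = ?T E \<and> ?w (sym_diff E D) = ?w E"
        using star_toggle_invariant(1)[OF E F assms(1)] by simp
    qed simp
    also have "\<dots> \<le> (\<Sum>E\<in>Pow (vertex_pairs n). pot k0 q t E F / (2 * n))"
      unfolding pot_def Let_def by (intro sum_mono hk) simp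
    finally show ?thesis by (simp add: gain1_def Let_def h_def sum_divide_distrib)
  qed
  show "(\<Sum>F\<in>Pow (vertex_pairs n). gain2 k0 q t E F) \<le> (\<Sum>F\<in>Pow (vertex_pairs n). pot k0 q t E F) / (2 * n)"
    if E: "E \<subseteq> vertex_pairs n"
  proof -
    let ?S = "\<lambda>F. S1 (state_at t E F)" and ?T = "\<lambda>F. S2 (state_at t E F)" and ?w = "\<lambda>F. snd (pick t E F)"
    have "(\<Sum>F\<in>Pow (vertex_pairs n). h (card (?T F)) *
            (\<Sum>v\<in>{1..n} - ?S F. real (card (isos F (insert (?w F) (?T F)) E (insert v (?S F))))))
       \<le> (\<Sum>F\<in>Pow (vertex_pairs n). h (card (?T F)) * card {1..n} * (card (?T F) + 1) / 2 ^ card (?T F)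
              * card (isos F (?T F) E (?S F)))"
    proof (rule sum_fresh_vertex_isos[OF finite_vertex_pairs _ h0])
      fix F assume F: "F \<subseteq> vertex_pairs n"
      note inv = state_at_invariant[OF E F less_imp_le[OF assms(1)]]
      show "isos F (?T F) E (?S F) \<noteq> {}" using inv isos_inverse by blast
      show "?w F \<notin> ?T F" using pick_fresh[OF E F assms(1)] inv by auto
      show "(\<lambda>x. {?w F, x}) ` ?T F \<subseteq> vertex_pairs n" by (rule star_subset_vertex_pairs[OF E F assms(1)])
      show "finite (?T F) \<and> finite (?S F) \<and> card (?T F) = card (?S F)"
        using state_at_finite[OF E F less_imp_le[OF assms(1)]] by simp
      fix D assume "D \<subseteq> (\<lambda>x. {?w F, x}) ` ?T F"
      then show "?T (sym_diff F D) = ?T F \<and> ?S (sym_diff F D) = ?S F \<and> ?w (sym_diff F D) = ?w F"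
        using star_toggle_invariant(2)[OF E F assms(1)] by simp
    qed simp
    also have "\<dots> \<le> (\<Sum>F\<in>Pow (vertex_pairs n). pot k0 q t E F / (2 * n))"
    proof (rule sum_mono)
      fix F assume "F \<in> Pow (vertex_pairs n)"
      then have fin: "finite (?S F)" "finite (?T F)" "card (?S F) = card (?T F)"
        using state_at_finite[OF E _ less_imp_le[OF assms(1)]] by auto
      show "h (card (?T F)) * card {1..n} * (card (?T F) + 1) / 2 ^ card (?T F)
              * card (isos F (?T F) E (?S F)) \<le> pot k0 q t E F / (2 * n)"
        \<comment> \<open>The potential is written from the side of the first graph; equal sizes and
          inversion of isomorphisms translate it.\<close>
        unfolding pot_def Let_def fin(3) card_isos_commute[OF fin(1,2), of E F]
        by (rule hk) simp
    qed
    finally show ?thesis by (simp add: gain2_def Let_def h_def sum_divide_distrib)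
  qed
qed

text \<open>The two gains together contribute a factor of at most \<open>1 + 1 / n\<close> per
  round. At the start the sets are empty and \<open>k0\<close> is positive, so every pair of graphs
  has potential \<open>k0 ^ k0\<close>.\<close>

lemma sum_pot_le:
  assumes "t \<le> n" "0 < k0" and q: "q = 2 * real n ^ 2 * (real k0 + 1) / 2 ^ k0"
  shows "(\<Sum>E\<in>Pow (vertex_pairs n). \<Sum>F\<in>Pow (vertex_pairs n). pot k0 q t E F)
      \<le> (1 + 1 / n) ^ t * (real (card (Pow (vertex_pairs n))) ^ 2 * real k0 ^ k0)"
  using assms(1)
proof (induction t)
  case 0
  show ?case using assms(2) by (simp add: pot_def state_at_def power2_eq_square)
next
  case (Suc t)
  let ?V = "Pow (vertex_pairs n)"
  define Z where "Z = (\<Sum>E\<in>?V. \<Sum>F\<in>?V. pot k0 q t E F)"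
  have qpos: "q > 0" using assms Suc by simp
  have "(\<Sum>E\<in>?V. \<Sum>F\<in>?V. pot k0 q (Suc t) E F)
      \<le> (\<Sum>E\<in>?V. \<Sum>F\<in>?V. pot k0 q t E F + gain1 k0 q t E F + gain2 k0 q t E F)"
    using Suc qpos by (intro sum_mono pot_Suc_le) auto
  \<comment> \<open>The order of summation is exchanged for \<open>gain1\<close> only, so that each
    inner sum runs over the graph with the fresh vertex.\<close>
  also have "\<dots> = Z + (\<Sum>F\<in>?V. \<Sum>E\<in>?V. gain1 k0 q t E F) + (\<Sum>E\<in>?V. \<Sum>F\<in>?V. gain2 k0 q t E F)"
    unfolding Z_def sum.distrib by (subst sum.swap[of "gain1 k0 q t"]) simp
  also have "\<dots> \<le> Z + (\<Sum>F\<in>?V. (\<Sum>E\<in>?V. pot k0 q t E F) / (2 * n))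
      + (\<Sum>E\<in>?V. (\<Sum>F\<in>?V. pot k0 q t E F) / (2 * n))"
    using Suc assms by (intro add_mono sum_mono sum_gain_le order.refl) auto
  also have "\<dots> = Z + Z / (2 * n) + Z / (2 * n)"
    unfolding Z_def sum_divide_distrib[symmetric] by (subst sum.swap) simp
  also have "\<dots> = (1 + 1 / n) * Z"
    using Suc by (simp add: field_simps)
  also have "\<dots> \<le> (1 + 1 / n) * ((1 + 1 / n) ^ t * (real (card ?V) ^ 2 * real k0 ^ k0))"
    using Suc by (intro mult_left_mono) (auto simp: Z_def)
  finally show ?case by (simp add: mult.assoc)
qed

section \<open>From the potential to the tail bound\<close>

text \<open>This is Markov's inequality: at size at least \<open>m\<close> some isomorphism exists,
  so the potential is at least \<open>(1 / q) ^ (m - k0)\<close>.\<close>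

lemma card_large_le:
  assumes "0 < n" "0 < k0" "k0 \<le> m" and q: "q = 2 * real n ^ 2 * (real k0 + 1) / 2 ^ k0" and "q \<le> 1"
  shows "real (card {(E, F) \<in> Pow (vertex_pairs n) \<times> Pow (vertex_pairs n). m \<le> card (S1 (state_at n E F))})
      \<le> 3 * real k0 ^ k0 * q ^ (m - k0) * real (card (Pow (vertex_pairs n))) ^ 2"
proof -
  let ?V = "Pow (vertex_pairs n)"
  let ?L = "{(E, F) \<in> ?V \<times> ?V. m \<le> card (S1 (state_at n E F))}"
  have finV: "finite ?V"
    by (simp add: finite_vertex_pairs)
  have qpos: "q > 0" using assms by simp
  have pot0: "pot k0 q n E F \<ge> 0" for E F using qpos by (simp add: pot_def Let_def)
  have large: "(1 / q) ^ (m - k0) \<le> pot k0 q n E F" if "(E, F) \<in> ?L" for E F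
  proof -
    define k where "k = card (S1 (state_at n E F))"
    have EF: "E \<subseteq> vertex_pairs n" "F \<subseteq> vertex_pairs n" "m \<le> k"
      using that by (auto simp: k_def)
    have "card (isos E (S1 (state_at n E F)) F (S2 (state_at n E F))) \<noteq> 0"
      using state_at_invariant[OF EF(1,2), of n] state_at_finite[OF EF(1,2), of n]
      by (simp add: finite_isos)
    then have "1 \<le> card (isos E (S1 (state_at n E F)) F (S2 (state_at n E F)))" by simp
    \<comment> \<open>As \<open>q \<le> 1\<close>, sizes beyond \<open>m\<close> only increase the
      weight.\<close>
    then have "(1 / q) ^ (m - k0) * 1 \<le>
        (1 / q) ^ (k - k0) * real (card (isos E (S1 (state_at n E F)) F (S2 (state_at n E F))))"
      using EF(3) qpos \<open>q \<le> 1\<close> by (intro mult_mono power_increasing) auto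
    then show ?thesis using EF(3) assms(3) by (simp add: pot_def Let_def k_def)
  qed
  have "card ?L * (1 / q) ^ (m - k0) = (\<Sum>(E, F)\<in>?L. (1 / q) ^ (m - k0))" by simp
  also have "\<dots> \<le> (\<Sum>(E, F)\<in>?L. pot k0 q n E F)"
    using large by (intro sum_mono) auto
  also have "\<dots> \<le> (\<Sum>(E, F)\<in>?V \<times> ?V. pot k0 q n E F)"
    using finV pot0 by (intro sum_mono2) auto
  also have "\<dots> = (\<Sum>E\<in>?V. \<Sum>F\<in>?V. pot k0 q n E F)"
    by (simp add: sum.cartesian_product)
  also have "\<dots> \<le> (1 + 1 / n) ^ n * (real (card ?V) ^ 2 * real k0 ^ k0)"
    by (rule sum_pot_le) (use assms in auto)
  also have "\<dots> \<le> 3 * (real (card ?V) ^ 2 * real k0 ^ k0)"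
  proof (rule mult_right_mono)
    have "(1 + 1 / real n) ^ n \<le> exp 1"
      using exp_ge_one_plus_x_over_n_power_n[of n 1] assms(1) by simp
    then show "(1 + 1 / real n) ^ n \<le> 3" using exp_le by linarith
  qed simp
  finally have "card ?L * (1 / q) ^ (m - k0) * q ^ (m - k0) \<le> 3 * (real (card ?V) ^ 2 * real k0 ^ k0) * q ^ (m - k0)"
    using qpos by (intro mult_right_mono) auto
  then show ?thesis using qpos by (simp add: power_one_over field_simps)
qed

text \<open>At edge probability 1/2 the edge sets are uniform and independent, so the probability is
  the proportion of pairs counted before.\<close>

lemma prob_large_le:
  assumes "0 < n" "0 < k0" "k0 \<le> m" and q: "q = 2 * real n ^ 2 * (real k0 + 1) / 2 ^ k0" and "q \<le> 1"
  shows "measure_pmf.prob (pair_pmf (erdos_renyi n (1/2)) (erdos_renyi n (1/2)))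
      {(G, H). m \<le> online_size n A G H \<omega>} \<le> 3 * real k0 ^ k0 * q ^ (m - k0)"
proof -
  let ?V = "Pow (vertex_pairs n)"
  have finV: "finite ?V"
    by (simp add: finite_vertex_pairs)
  have er: "erdos_renyi n (1/2) = map_pmf (\<lambda>E. ({1..n}, E)) (pmf_of_set ?V)"
    unfolding erdos_renyi_def pmf_of_set_Pow_conv_bernoulli[OF finite_vertex_pairs, where P = False, symmetric]
    by (simp add: pmf.map_comp o_def)
  have pair: "pair_pmf (pmf_of_set ?V) (pmf_of_set ?V) = pmf_of_set (?V \<times> ?V)"
  proof (rule pmf_eqI)
    fix x :: "nat set set \<times> nat set set"
    have "?V \<noteq> {}" "?V \<times> ?V \<noteq> {}" by auto
    then show "pmf (pair_pmf (pmf_of_set ?V) (pmf_of_set ?V)) x = pmf (pmf_of_set (?V \<times> ?V)) x"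
      using finV by (cases x) (simp add: pmf_pair card_cartesian_product indicator_def del: Pow_iff)
  qed
  have "measure_pmf.prob (pair_pmf (erdos_renyi n (1/2)) (erdos_renyi n (1/2)))
      {(G, H). m \<le> online_size n A G H \<omega>}
    = measure_pmf.prob (pmf_of_set (?V \<times> ?V)) {(E, F). m \<le> card (S1 (state_at n E F))}"
    unfolding er pair_map_pmf1 pair_map_pmf2 pair pmf.map_comp
    by (simp add: vimage_def case_prod_unfold o_def online_size_def online_output_def verts_def
        induced_def state_at_def)
  also have "\<dots> = card ((?V \<times> ?V) \<inter> {(E, F). m \<le> card (S1 (state_at n E F))}) / card (?V \<times> ?V)"
    using finV by (subst measure_pmf_of_set) auto
  also have "(?V \<times> ?V) \<inter> {(E, F). m \<le> card (S1 (state_at n E F))}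
      = {(E, F) \<in> ?V \<times> ?V. m \<le> card (S1 (state_at n E F))}" by auto
  also have "real (card \<dots>) / card (?V \<times> ?V)
      \<le> (3 * real k0 ^ k0 * q ^ (m - k0) * real (card ?V) ^ 2) / card (?V \<times> ?V)"
    by (intro divide_right_mono card_large_le assms) auto
  also have "\<dots> = 3 * real k0 ^ k0 * q ^ (m - k0)"
    using finV by (simp add: card_cartesian_product power2_eq_square card_Pow)
  finally show ?thesis .
qed

end

section \<open>Choice of the parameters and asymptotics\<close>

theorem theorem1p5:
  fixes \<epsilon> :: real
  assumes "\<epsilon> > 0"
  shows "\<exists>c>0. \<exists>N. \<forall>n\<ge>N. \<forall>A \<in> (ONLINE n :: 'w online_alg set). \<forall>\<omega>.
           measure_pmf.prob (pair_pmf (erdos_renyi n (1/2)) (erdos_renyi n (1/2)))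
             {(G1, G2). real (online_size n A G1 G2 \<omega>) \<ge> (2 + \<epsilon>) * log 2 (real n)}
           \<le> real n powr (- (c * log 2 (real n)))"
proof -
  \<comment> \<open>The exponent obtained below is asymptotically \<open>\<epsilon> ^ 2 / 4\<close>
    times the square of \<open>log 2 n\<close>; half of it absorbs the lower order terms.\<close>
  define c where "c = \<epsilon> ^ 2 / 8"
  \<comment> \<open>At \<open>x = log 2 n\<close> this bounds both \<open>log 2 k0\<close> and
    \<open>log 2 (k0 + 1)\<close>, the rounding up of \<open>k0\<close> included.\<close>
  define l where "l = (\<lambda>x. log 2 ((2 + \<epsilon> / 2) * x + 2))"
  have "eventually (\<lambda>x::real. x > 0) at_top" "eventually (\<lambda>x. 1 + l x - \<epsilon> / 2 * x \<le> 0) at_top"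
    unfolding l_def using assms by real_asymp+
  \<comment> \<open>The three summands will bound the logarithms of \<open>3\<close>, of
    \<open>k0 ^ k0\<close> and of \<open>q ^ (m - k0)\<close>; the last factor bounds
    \<open>log 2 q\<close>.\<close>
  moreover have "eventually (\<lambda>x. 2 + ((2 + \<epsilon> / 2) * x + 1) * l x
      + (\<epsilon> / 2 * x - 1) * (1 + l x - \<epsilon> / 2 * x) \<le> - (c * x ^ 2)) at_top"
  proof -
    have "((\<lambda>x. (2 + ((2 + \<epsilon> / 2) * x + 1) * l x
      + (\<epsilon> / 2 * x - 1) * (1 + l x - \<epsilon> / 2 * x)) / x ^ 2) \<longlongrightarrow> - (\<epsilon> ^ 2 / 4)) at_top"
      unfolding l_def using assms by (real_asymp simp: power2_eq_square field_simps)
    moreover have "- (\<epsilon> ^ 2 / 4) < - c" using assms by (simp add: c_def)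
    ultimately have "eventually (\<lambda>x. (2 + ((2 + \<epsilon> / 2) * x + 1) * l x
      + (\<epsilon> / 2 * x - 1) * (1 + l x - \<epsilon> / 2 * x)) / x ^ 2 < - c) at_top"
      by (rule order_tendstoD)
    then show ?thesis
      using eventually_gt_at_top[of "0 :: real"]
      by eventually_elim (simp add: field_simps)
  qed
  ultimately have "eventually (\<lambda>x. x > 0 \<and> 1 + l x - \<epsilon> / 2 * x \<le> 0 \<and>
      2 + ((2 + \<epsilon> / 2) * x + 1) * l x + (\<epsilon> / 2 * x - 1) * (1 + l x - \<epsilon> / 2 * x) \<le> - (c * x ^ 2)) at_top"
    by eventually_elim auto
  moreover have "filterlim (\<lambda>n. log 2 (real n)) at_top sequentially"
    by real_asymp
  ultimately have "eventually (\<lambda>n. log 2 (real n) > 0 \<and> 1 + l (log 2 n) - \<epsilon> / 2 * log 2 n \<le> 0 \<and>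
      2 + ((2 + \<epsilon> / 2) * log 2 n + 1) * l (log 2 n)
        + (\<epsilon> / 2 * log 2 n - 1) * (1 + l (log 2 n) - \<epsilon> / 2 * log 2 n) \<le> - (c * (log 2 n) ^ 2)) sequentially"
    by (rule eventually_compose_filterlim)
  then obtain N where N: "\<And>n. n \<ge> N \<Longrightarrow> log 2 (real n) > 0 \<and> 1 + l (log 2 n) - \<epsilon> / 2 * log 2 n \<le> 0 \<and>
      2 + ((2 + \<epsilon> / 2) * log 2 n + 1) * l (log 2 n)
        + (\<epsilon> / 2 * log 2 n - 1) * (1 + l (log 2 n) - \<epsilon> / 2 * log 2 n) \<le> - (c * (log 2 n) ^ 2)"
    by (auto simp: eventually_sequentially)
  have "measure_pmf.prob (pair_pmf (erdos_renyi n (1/2)) (erdos_renyi n (1/2)))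
             {(G1, G2). real (online_size n A G1 G2 \<omega>) \<ge> (2 + \<epsilon>) * log 2 (real n)}
           \<le> real n powr (- (c * log 2 (real n)))"
    if "n \<ge> N" and A: "A \<in> ONLINE n" for n and A :: "'w online_alg" and \<omega>
  proof -
    interpret online_play n A \<omega> by standard (rule A)
    define L where "L = log 2 (real n)"
    \<comment> \<open>The threshold lies halfway between \<open>2 * L\<close> and the target: half
      of the excess makes \<open>q\<close> about \<open>n powr (- \<epsilon> / 2)\<close>, the other
      half is the number of factors \<open>q\<close>.\<close>
    define k0 where "k0 = nat \<lceil>(2 + \<epsilon> / 2) * L\<rceil>"
    define m where "m = nat \<lceil>(2 + \<epsilon>) * L\<rceil>"
    define q where "q = 2 * real n ^ 2 * (real k0 + 1) / 2 ^ k0"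
    define y where "y = 1 + l L - \<epsilon> / 2 * L"
    have L: "L > 0" and y: "y \<le> 0"
      and bound: "2 + ((2 + \<epsilon> / 2) * L + 1) * l L + (\<epsilon> / 2 * L - 1) * y \<le> - (c * L ^ 2)"
      using N[OF \<open>n \<ge> N\<close>] by (auto simp: L_def y_def)
    \<comment> \<open>By convention \<open>log 2 0\<close> is 0, so positive \<open>L\<close>
      excludes \<open>n = 0\<close>.\<close>
    have n: "n > 0" using L by (cases n) (auto simp: L_def log_def)
    have "(2 + \<epsilon> / 2) * L > 0" using L assms by simp
    then have k0: "k0 > 0" "real k0 \<ge> (2 + \<epsilon> / 2) * L" "real k0 \<le> (2 + \<epsilon> / 2) * L + 1"
      unfolding k0_def by linarith+
    have "(2 + \<epsilon> / 2) * L \<le> (2 + \<epsilon>) * L" using L assms by (intro mult_right_mono) auto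
    then have km: "k0 \<le> m" unfolding k0_def m_def by (intro nat_mono ceiling_mono)
    have "real m \<ge> (2 + \<epsilon>) * L" unfolding m_def by linarith
    then have mk: "real (m - k0) \<ge> \<epsilon> / 2 * L - 1"
      using k0(3) km by (simp add: of_nat_diff algebra_simps)
    have qpos: "q > 0" using n by (simp add: q_def)
    have lk: "log 2 (real k0 + 1) \<le> l L"
      unfolding l_def using k0(3) by simp
    have lk': "log 2 (real k0) \<le> l L"
      unfolding l_def using k0 by simp
    have "log 2 q = 1 + 2 * L + log 2 (real k0 + 1) - k0"
      using n unfolding q_def L_def by (subst log_divide, simp, simp) (simp add: log_mult log_nat_power)
    then have logq: "log 2 q \<le> y"
      using lk k0(2) by (simp add: y_def algebra_simps)
    then have q1: "q \<le> 1" using y qpos log_le_zero_cancel_iff[of 2 q] by linarith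
    have "log 2 (3 * real k0 ^ k0 * q ^ (m - k0)) = log 2 3 + k0 * log 2 k0 + (m - k0) * log 2 q"
      using k0(1) qpos by (simp add: log_mult_pos log_nat_power)
    also have "\<dots> \<le> 2 + ((2 + \<epsilon> / 2) * L + 1) * l L + (\<epsilon> / 2 * L - 1) * y"
    proof (intro add_mono)
      have "log 2 3 \<le> log 2 (4 :: real)" by simp
      also have "log 2 (4 :: real) = log 2 (2 ^ 2)" by simp
      also have "\<dots> = 2" by (subst log_nat_power) auto
      finally show "log 2 3 \<le> (2 :: real)" .
      have "log 2 (real k0) \<ge> 0" using k0(1) by simp
      then show "k0 * log 2 k0 \<le> ((2 + \<epsilon> / 2) * L + 1) * l L"
        using k0 lk' by (intro mult_mono) auto
      have "real (m - k0) * log 2 q \<le> real (m - k0) * y"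
        by (intro mult_left_mono logq) auto
      \<comment> \<open>Since \<open>y \<le> 0\<close>, the lower bound on \<open>m - k0\<close>
        gives an upper bound on the product.\<close>
      also have "\<dots> \<le> (\<epsilon> / 2 * L - 1) * y"
        by (intro mult_right_mono_neg mk y)
      finally show "(m - k0) * log 2 q \<le> (\<epsilon> / 2 * L - 1) * y" .
    qed
    also have "\<dots> \<le> - (c * L ^ 2)" by (rule bound)
    also have "\<dots> = log 2 (real n powr (- (c * L)))"
      using n by (simp add: log_powr L_def power2_eq_square)
    finally have final: "3 * real k0 ^ k0 * q ^ (m - k0) \<le> real n powr (- (c * L))"
      using n k0(1) qpos by simp
    \<comment> \<open>Sizes are integers, so the real threshold can be rounded up to
      \<open>m\<close>.\<close>
    have "{(G1, G2). real (online_size n A G1 G2 \<omega>) \<ge> (2 + \<epsilon>) * L}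
        = {(G, H). m \<le> online_size n A G H \<omega>}"
      by (simp add: m_def nat_ceiling_le_eq)
    then show ?thesis
      using prob_large_le[OF n k0(1) km q_def q1] final by (simp add: L_def)
  qed
  moreover have "c > 0" using assms by (simp add: c_def)
  ultimately show ?thesis by blast
qed

end
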